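(* Consider the Poisson $i\mathcal{S}$-graph with legitimate-node density $\lambda_\ell>0$, eavesdropper density $\lambda_{\mathrm e}>0$, path loss only with gain $g(r)=1/r^{2b}$, transmit power $P_\ell>0$, and common noise power $\sigma^2>0$. For $i\ge1$, the maximum secrecy rate $\mathcal{R}_{\mathrm s,i}$ between a typical node and its $i$-th closest neighbour is a random variable whose cumulative distribution function is given, for $\varrho\ge0$, by $$F_{\mathcal{R}_{\mathrm s,i}}(\varrho)=1-\frac{\ln 2\,(\pi\lambda_\ell)^{i}}{(i-1)!\,b}\left(\frac{P_\ell}{\sigma^2}\right)^{\frac ib}\int_{\varrho}^{+\infty}\frac{2^{z}}{(2^{z}-1)^{1+\frac ib}}\exp\left(-\pi\lambda_\ell\left(\frac{P_\ell/\sigma^2}{2^{z}-1}\right)^{\frac1b}-\pi\lambda_{\mathrm e}\left(\frac{P_\ell/\sigma^2}{2^{z-\varrho}-1}\right)^{\frac1b}\right)dz.$$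
   Context: $\Pi_\ell$ (legitimate nodes) and $\Pi_{\mathrm e}$ (eavesdroppers) are mutually independent homogeneous Poisson point processes on $\mathbb{R}^2$ with densities $\lambda_\ell,\lambda_{\mathrm e}$; $b>0$. The typical node is placed at the origin. $R_{\ell,1}\le R_{\ell,2}\le\cdots$ are the ordered distances from the origin to the points of $\Pi_\ell$, and $R_{\mathrm e,1}$ is the distance from the origin to the closest point of $\Pi_{\mathrm e}$. The maximum secrecy rate to the $i$-th closest legitimate node is $$\mathcal{R}_{\mathrm s,i}=\left[\log_2\left(1+\frac{P_\ell}{R_{\ell,i}^{2b}\sigma^2}\right)-\log_2\left(1+\frac{P_\ell}{R_{\mathrm e,1}^{2b}\sigma^2}\right)\right]^+,\qquad [t]^+=\max\{t,0\}.$$ *)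

theory Defs
  imports "HOL-Probability.Probability"
begin

definition locally_finite_set :: "'a::metric_space set \<Rightarrow> bool" where
  "locally_finite_set S \<longleftrightarrow> (\<forall>B. bounded B \<longrightarrow> finite (S \<inter> B))"

text \<open>
  A simple point process is a random element of the space of locally finite sets, equipped with
  the smallest sigma-algebra that makes all counting maps \<open>S \<mapsto> card (S \<inter> A)\<close>, with \<open>A\<close>
  bounded Borel, measurable.
\<close>

definition configurations :: "'a::euclidean_space set measure" where
  "configurations =
     sigma {S. locally_finite_set S}
           {{S. locally_finite_set S \<and> card (S \<inter> A) = n} | A n. A \<in> sets borel \<and> bounded A}"

text \<open>
  The Poisson probabilities are written out because \<open>poisson_pmf\<close> is specified for
  positive rates only, whereas null sets \<open>A\<close> have rate \<open>0\<close>; note \<open>0 ^ 0 = 1\<close>.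
\<close>

definition (in prob_space) poisson_process :: "real \<Rightarrow> ('a \<Rightarrow> 'b::euclidean_space set) \<Rightarrow> bool" where
  "poisson_process lam \<Phi> \<longleftrightarrow>
     random_variable configurations \<Phi> \<and>
     (\<forall>A n. A \<in> sets borel \<and> bounded A \<longrightarrow>
        prob {\<omega> \<in> space M. card (\<Phi> \<omega> \<inter> A) = n} =
          (lam * measure lborel A) ^ n / fact n * exp (- (lam * measure lborel A))) \<and>
     (\<forall>A :: nat \<Rightarrow> 'b set. (\<forall>j. A j \<in> sets borel \<and> bounded (A j)) \<and> disjoint_family A \<longrightarrow>
        indep_vars (\<lambda>_. count_space UNIV) (\<lambda>j \<omega>. card (\<Phi> \<omega> \<inter> A j)) UNIV)"

text \<open>
  The points of \<open>S\<close> enumerated (from index 1) by nondecreasing distance to the origin. Ties make the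
  enumeration non-unique but do not affect \<open>ordered_dist\<close>. The values are meaningful when \<open>S\<close> is
  infinite and locally finite, which holds almost surely for a Poisson process of positive density.
\<close>

definition ith_closest :: "'a::real_normed_vector set \<Rightarrow> nat \<Rightarrow> 'a" where
  "ith_closest S = (SOME x. bij_betw x {1..} S \<and> mono_on {1..} (\<lambda>i. dist 0 (x i)))"

definition ordered_dist :: "'a::real_normed_vector set \<Rightarrow> nat \<Rightarrow> real" where
  "ordered_dist S i = dist 0 (ith_closest S i)"

text \<open>
  Maximum secrecy rate from the origin to the \<open>i\<close>-th closest legitimate node, for legitimate nodes
  \<open>L\<close>, eavesdroppers \<open>E\<close>, transmit power \<open>P\<close>, common noise power \<open>s2\<close> and path loss gain
  \<open>g r = 1 / r powr (2 * b)\<close>, so that \<open>P / (r powr (2 * b) * s2)\<close> is the signal-to-noise ratio at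
  distance \<open>r\<close>. The distance to the closest eavesdropper is \<open>infdist 0 E\<close>.
\<close>

definition max_secrecy_rate ::
    "real \<Rightarrow> real \<Rightarrow> real \<Rightarrow> 'a::real_normed_vector set \<Rightarrow> 'a set \<Rightarrow> nat \<Rightarrow> real" where
  "max_secrecy_rate b P s2 L E i =
     max (log 2 (1 + P / (ordered_dist L i powr (2 * b) * s2))
          - log 2 (1 + P / (infdist 0 E powr (2 * b) * s2))) 0"

end

theory Submission
  imports Defs
begin

text \<open>
  For a Poisson process in the plane, the number of points within distance \<open>r\<close> of the origin is
  Poisson with mean \<open>\<pi> \<lambda> r\<^sup>2\<close>. Hence the squared distance to the \<open>i\<close>-th closest point is Erlang with
  shape \<open>i\<close> and rate \<open>\<pi> \<lambda>\<close>. The secrecy rate is the positive part of a difference of the same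
  decreasing function evaluated at two independent squared distances. Conditioning on the legitimate
  one, the event that the secrecy rate exceeds \<open>\<rho>\<close> becomes the event that the closest eavesdropper
  lies outside a certain disc, whose probability is exponential in the squared radius. Changing
  variables from the squared distance to the corresponding rate \<open>z\<close> then yields the integral.
\<close>

subsection \<open>Distances in locally finite configurations\<close>

text \<open>The points are picked greedily: each stage takes a closest point among those not yet
  taken, which exists because every ball contains only finitely many points. No point is missed,
  since a missed point would be at least as far as every chosen one and so force infinitely many
  points into one ball.\<close>

lemma ex_ordered_enumeration:
  fixes S :: "'a::real_normed_vector set"
  assumes "locally_finite_set S" and "infinite S"
  shows "\<exists>x. bij_betw x {1::nat..} S \<and> mono_on {1..} (\<lambda>i. dist 0 (x i))"
proof -
  define Q where "Q = (\<lambda>(f :: nat \<Rightarrow> 'a) n s.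
    s \<in> S - f ` {..<n} \<and> (\<forall>t \<in> S - f ` {..<n}. norm s \<le> norm t))"
  have ex: "\<exists>s. Q f n s" for f n
  proof -
    have "infinite (S - f ` {..<n})"
      using assms(2) by (intro Diff_infinite_finite) auto
    then obtain s0 where s0: "s0 \<in> S - f ` {..<n}"
      using infinite_imp_nonempty by blast
    \<comment> \<open>Remaining points outside this ball are farther away than \<open>s0\<close>, so
      a minimiser of the norm over the finite set \<open>B\<close> is a minimiser over all remaining
      points.\<close>
    define B where "B = (S - f ` {..<n}) \<inter> cball 0 (norm s0)"
    have "finite (S \<inter> cball 0 (norm s0))"
      using assms(1) unfolding locally_finite_set_def by blast
    then have finB: "finite B" unfolding B_def by (rule rev_finite_subset) auto
    have "s0 \<in> B" using s0 by (auto simp: B_def)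
    then have "B \<noteq> {}" by auto
    then obtain s where s: "s \<in> B" "\<And>t. t \<in> B \<Longrightarrow> norm s \<le> norm t"
      using arg_min_if_finite(1)[OF finB, of norm] arg_min_least[OF finB, of _ norm] by metis
    have "norm s \<le> norm t" if "t \<in> S - f ` {..<n}" for t
    proof (cases "t \<in> B")
      case False
      then have "norm s0 < norm t" using that by (auto simp: B_def)
      moreover have "norm s \<le> norm s0" using s \<open>s0 \<in> B\<close> by blast
      ultimately show ?thesis by simp
    qed (use s in blast)
    then show ?thesis using s(1) unfolding Q_def B_def by blast
  qed
  have "\<exists>f. \<forall>n::nat. Q f n (f n)"
  \<comment> \<open>\<open>Q\<close> looks at \<open>f\<close> only below \<open>n\<close>, so the
    choices can be made by well-founded recursion.\<close>
  proof (rule dependent_wf_choice[of less_than Q])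
    show "Q f n r = Q g n r" if "\<And>z. (z, n) \<in> less_than \<Longrightarrow> f z = g z" for f g n r
    proof -
      have "f ` {..<n} = g ` {..<n}" using that by (intro image_cong) auto
      then show ?thesis by (simp add: Q_def)
    qed
  qed (use ex in auto)
  then obtain f where f: "\<And>n::nat. Q f n (f n)" by blast
  have inS: "f n \<in> S" and new: "f n \<notin> f ` {..<n}" for n
    using f[of n] by (auto simp: Q_def)
  have least: "norm (f n) \<le> norm t" if "t \<in> S" "t \<notin> f ` {..<n}" for n t
    using f[of n] that by (auto simp: Q_def)
  have inj: "inj f"
    by (rule linorder_injI) (metis new image_eqI lessThan_iff)
  have mono: "norm (f m) \<le> norm (f n)" if "m \<le> n" for m n
    using new[of n] that by (intro least inS) auto
  have surj: "s \<in> range f" if "s \<in> S" for s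
  proof (rule ccontr)
    assume "s \<notin> range f"
    then have "norm (f n) \<le> norm s" for n
      by (intro least[OF that]) auto
    then have "range f \<subseteq> S \<inter> cball 0 (norm s)"
      using inS by auto
    moreover have "finite (S \<inter> cball 0 (norm s))"
      using assms(1) unfolding locally_finite_set_def by blast
    ultimately show False
      using range_inj_infinite[OF inj] finite_subset by blast
  qed
  \<comment> \<open>The greedy sequence starts at index 0, whereas \<open>ith_closest\<close> counts
    from 1.\<close>
  have "bij_betw (\<lambda>i. i - 1) {1::nat..} UNIV"
    by (rule bij_betw_byWitness[where f' = Suc]) auto
  moreover have "bij_betw f UNIV S"
    using inj inS surj by (auto simp: bij_betw_def)
  ultimately have "bij_betw (f \<circ> (\<lambda>i. i - 1)) {1..} S"
    by (rule bij_betw_trans)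
  moreover have "mono_on {1..} (\<lambda>i. dist 0 ((f \<circ> (\<lambda>i. i - 1)) i))"
    by (intro mono_onI) (auto intro!: mono)
  ultimately show ?thesis by blast
qed

text \<open>Removes the choice operator from \<open>ordered_dist\<close>: what remains is a count in
  a ball, whose law the Poisson process prescribes. Monotone distances put the first
  \<open>i\<close> points into the ball as soon as the \<open>i\<close>-th one is there, and keep
  all points from index \<open>i\<close> on outside otherwise.\<close>

lemma ordered_dist_le_iff:
  fixes S :: "'a::real_normed_vector set"
  assumes S: "locally_finite_set S" "infinite S" and "i \<ge> 1"
  shows "ordered_dist S i \<le> r \<longleftrightarrow> i \<le> card (S \<inter> cball 0 r)"
proof -
  define x where "x = ith_closest S"
  have bij: "bij_betw x {1..} S" and mono: "mono_on {1..} (\<lambda>i. dist 0 (x i))"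
    using someI_ex[OF ex_ordered_enumeration[OF S]] unfolding x_def ith_closest_def by auto
  have fin: "finite (S \<inter> cball 0 r)"
    using S(1) unfolding locally_finite_set_def by blast
  have inj: "inj_on x {1..}" using bij by (rule bij_betw_imp_inj_on)
  have "i \<le> card (S \<inter> cball 0 r)" if "dist 0 (x i) \<le> r"
  proof -
    have "x j \<in> S \<inter> cball 0 r" if "j \<in> {1..i}" for j
    proof -
      have "dist 0 (x j) \<le> dist 0 (x i)" using that by (intro mono_onD[OF mono]) auto
      then show ?thesis
        using that \<open>dist 0 (x i) \<le> r\<close> bij_betwE[OF bij] by (auto simp del: dist_0_norm)
    qed
    then have "card (x ` {1..i}) \<le> card (S \<inter> cball 0 r)"
      using fin by (intro card_mono) auto
    moreover have "card (x ` {1..i}) = i"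
      using inj by (subst card_image) (auto intro: inj_on_subset)
    ultimately show ?thesis by simp
  qed
  moreover have "card (S \<inter> cball 0 r) < i" if "\<not> dist 0 (x i) \<le> r"
  proof -
    have "S \<inter> cball 0 r \<subseteq> x ` {1..<i}"
    proof
      fix s assume s: "s \<in> S \<inter> cball 0 r"
      then obtain j where j: "j \<ge> 1" "s = x j"
        using bij_betw_imp_surj_on[OF bij] by auto
      have "\<not> i \<le> j"
        using mono_onD[OF mono, of i j] \<open>i \<ge> 1\<close> j s that by (auto simp del: dist_0_norm)
      then show "s \<in> x ` {1..<i}" using j by auto
    qed
    then have "card (S \<inter> cball 0 r) \<le> card {1..<i}"
      by (meson card_image_le card_mono finite_atLeastLessThan finite_imageI le_trans)
    then show ?thesis using \<open>i \<ge> 1\<close> by simp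
  qed
  ultimately show ?thesis
    unfolding ordered_dist_def x_def[symmetric] by fastforce
qed

text \<open>The delicate case is a closed ball that misses \<open>S\<close>: local finiteness leaves
  only finitely many points just outside it, so the infimum is strictly larger than
  \<open>r\<close>.\<close>

lemma infdist_le_iff_card:
  fixes S :: "'a::real_normed_vector set"
  assumes S: "locally_finite_set S" "S \<noteq> {}"
  shows "infdist 0 S \<le> r \<longleftrightarrow> 1 \<le> card (S \<inter> cball 0 r)"
proof -
  have fin: "finite (S \<inter> cball 0 q)" for q
    using S(1) unfolding locally_finite_set_def by blast
  have "1 \<le> card (S \<inter> cball 0 r) \<longleftrightarrow> S \<inter> cball 0 r \<noteq> {}"
    using fin[of r] by (simp add: Suc_le_eq card_gt_0_iff)
  moreover have "infdist 0 S \<le> r" if "s \<in> S \<inter> cball 0 r" for s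
    using infdist_le[of s S 0] that by auto
  moreover have "infdist 0 S > r" if empty: "S \<inter> cball 0 r = {}"
  proof -
    \<comment> \<open>A lower bound for all distances that still exceeds \<open>r\<close>: the
      finitely many points within \<open>r + 1\<close> all lie beyond \<open>r\<close>, and the
      others lie beyond \<open>r + 1\<close>.\<close>
    define m where "m = Min (insert (r + 1) (dist 0 ` (S \<inter> cball 0 (r + 1))))"
    have "m > r"
      using empty fin by (auto simp: m_def)
    moreover have "m \<le> dist 0 s" if "s \<in> S" for s
    proof (cases "s \<in> cball 0 (r + 1)")
      case True
      then show ?thesis using that fin unfolding m_def by (intro Min_le) auto
    next
      case False
      have "m \<le> r + 1" using fin unfolding m_def by (intro Min_le) auto
      then show ?thesis using False by auto
    qed
    then have "m \<le> infdist 0 S"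
      using S(2) by (auto simp: infdist_def intro: cINF_greatest)
    ultimately show ?thesis by simp
  qed
  ultimately show ?thesis by (metis ex_in_conv not_less)
qed

section \<open>Measurability of the distances on the space of configurations\<close>

lemma space_configurations: "space configurations = {S. locally_finite_set S}"
  unfolding configurations_def by (rule space_measure_of) auto

lemma measurable_card_Int [measurable]:
  assumes "A \<in> sets borel" "bounded A"
  shows "(\<lambda>S. card (S \<inter> A)) \<in> measurable configurations (count_space UNIV)"
proof (rule measurable_count_space_eq2_countable[THEN iffD2], safe)
  fix n
  have "(\<lambda>S. card (S \<inter> A)) -` {n} \<inter> space configurations =
      {S. locally_finite_set S \<and> card (S \<inter> A) = n}"
    by (auto simp: space_configurations)
  also have "\<dots> \<in> sets configurations"
    unfolding configurations_def using assms by (subst sets_measure_of) auto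
  finally show "(\<lambda>S. card (S \<inter> A)) -` {n} \<inter> space configurations \<in> sets configurations" .
qed auto

text \<open>Countably many ball counts decide whether a configuration is infinite, which makes this
  a measurable event. Any \<open>n\<close> points fit into some ball of integer radius.\<close>

lemma infinite_iff_card_cball:
  fixes S :: "'a::real_normed_vector set"
  assumes "locally_finite_set S"
  shows "infinite S \<longleftrightarrow> (\<forall>n. \<exists>k::nat. n \<le> card (S \<inter> cball 0 (real k)))"
proof safe
  fix n assume "infinite S"
  then obtain T where T: "T \<subseteq> S" "finite T" "card T = n"
    using infinite_arbitrarily_large by blast
  obtain r where "T \<subseteq> cball 0 r"
    using finite_imp_bounded[OF T(2)] by (auto simp: bounded_iff subset_iff)
  obtain k :: nat where "r \<le> real k" using real_arch_simple by blast
  then have "T \<subseteq> S \<inter> cball 0 (real k)" using T \<open>T \<subseteq> cball 0 r\<close> by force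
  moreover have "finite (S \<inter> cball 0 (real k))"
    using assms unfolding locally_finite_set_def by blast
  ultimately show "\<exists>k::nat. n \<le> card (S \<inter> cball 0 (real k))"
    using T(3) card_mono by blast
next
  assume all: "\<forall>n. \<exists>k::nat. n \<le> card (S \<inter> cball 0 (real k))" and "finite S"
  from all obtain k :: nat where "Suc (card S) \<le> card (S \<inter> cball 0 (real k))" by blast
  moreover have "card (S \<inter> cball 0 (real k)) \<le> card S"
    using \<open>finite S\<close> by (intro card_mono) auto
  ultimately show False by simp
qed

lemma pred_infinite_configurations [measurable]:
  "Measurable.pred (configurations :: 'a::euclidean_space set measure) infinite"
proof (subst measurable_cong)
  show "Measurable.pred configurations
      (\<lambda>S::'a set. \<forall>n. \<exists>k::nat. n \<le> card (S \<inter> cball 0 (real k)))"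
    by measurable
qed (auto simp: space_configurations infinite_iff_card_cball)

lemma borel_measurable_ordered_dist [measurable]:
  assumes "i \<ge> 1"
  shows "(\<lambda>S::'a::euclidean_space set. ordered_dist S i) \<in> borel_measurable configurations"
proof -
  \<comment> \<open>For finite \<open>S\<close> no enumeration by \<open>{1..}\<close> exists, so
    the predicate in \<open>ith_closest\<close> is identically false and the choice returns this
    same sequence for every finite \<open>S\<close>. The distance is therefore constant on finite
    configurations.\<close>
  define x0 where "x0 = (SOME x :: nat \<Rightarrow> 'a. False)"
  have fin: "ordered_dist S i = dist 0 (x0 i)" if "finite S" for S :: "'a set"
  proof -
    have "\<not> bij_betw x {1::nat..} S" for x
      using that bij_betw_finite infinite_Ici by blast
    then show ?thesis by (simp add: ordered_dist_def ith_closest_def x0_def)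
  qed
  have "Measurable.pred configurations (\<lambda>S::'a set. ordered_dist S i \<le> r)" for r
  proof (subst measurable_cong)
    show "Measurable.pred configurations (\<lambda>S::'a set.
        if infinite S then i \<le> card (S \<inter> cball 0 r) else dist 0 (x0 i) \<le> r)"
      by measurable
  qed (use assms in \<open>auto simp: space_configurations ordered_dist_le_iff fin\<close>)
  then show ?thesis by (intro borel_measurableI_le) (simp add: pred_def)
qed

lemma borel_measurable_infdist_configurations [measurable]:
  "(\<lambda>S::'a::euclidean_space set. infdist 0 S) \<in> borel_measurable configurations"
proof -
  have "Measurable.pred configurations (\<lambda>S::'a set. infdist 0 S \<le> r)" for r
  proof (subst measurable_cong)
    fix S :: "'a set" assume "S \<in> space configurations"
    then have lf: "locally_finite_set S" by (simp add: space_configurations)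
    \<comment> \<open>The condition detects nonemptiness through countably many counts; the else
      branch is the default value \<open>infdist 0 {} = 0\<close>.\<close>
    show "infdist 0 S \<le> r \<longleftrightarrow> (if \<exists>k::nat. card (S \<inter> cball 0 (real k)) \<ge> 1
        then 1 \<le> card (S \<inter> cball 0 r) else 0 \<le> r)"
    proof (cases "S = {}")
      case False
      obtain k :: nat where "infdist 0 S \<le> real k" using real_arch_simple by blast
      then show ?thesis using infdist_le_iff_card[OF lf False] by auto
    qed (auto simp: infdist_def)
  qed measurable
  then show ?thesis by (intro borel_measurableI_le) (simp add: pred_def)
qed

subsection \<open>Distances in a planar Poisson process\<close>

lemma measure_lborel_cball_real2:
  "0 \<le> r \<Longrightarrow> measure lborel (cball c r :: (real ^ 2) set) = pi * r\<^sup>2"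
  by (simp add: content_cball unit_ball_vol_2)

context prob_space
begin

lemma poisson_process_measurable:
  "poisson_process lam \<Phi> \<Longrightarrow> random_variable configurations \<Phi>"
  by (simp add: poisson_process_def)

lemma poisson_process_locally_finite:
  "poisson_process lam \<Phi> \<Longrightarrow> \<omega> \<in> space M \<Longrightarrow> locally_finite_set (\<Phi> \<omega>)"
  using measurable_space[OF poisson_process_measurable] by (auto simp: space_configurations)

lemma prob_poisson_card_cball_le:
  fixes \<Phi> :: "'a \<Rightarrow> (real ^ 2) set"
  assumes pp: "poisson_process lam \<Phi>" and "0 \<le> r"
  shows "prob {\<omega> \<in> space M. card (\<Phi> \<omega> \<inter> cball 0 r) \<le> k} =
    (\<Sum>n\<le>k. (lam * pi * r\<^sup>2) ^ n / fact n * exp (- (lam * pi * r\<^sup>2)))"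
proof -
  note [measurable] = poisson_process_measurable[OF pp]
  define C where "C n = {\<omega> \<in> space M. card (\<Phi> \<omega> \<inter> cball 0 r) = n}" for n
  have [measurable]: "C n \<in> events" for n
    unfolding C_def by measurable
  have "prob (C n) = (lam * pi * r\<^sup>2) ^ n / fact n * exp (- (lam * pi * r\<^sup>2))" for n
    using pp \<open>0 \<le> r\<close> unfolding poisson_process_def C_def
    by (simp add: measure_lborel_cball_real2 mult.assoc)
  moreover have "prob (\<Union>n\<le>k. C n) = (\<Sum>n\<le>k. prob (C n))"
    by (intro finite_measure_finite_Union) (auto simp: disjoint_family_on_def C_def)
  moreover have "(\<Union>n\<le>k. C n) = {\<omega> \<in> space M. card (\<Phi> \<omega> \<inter> cball 0 r) \<le> k}"
    by (auto simp: C_def)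
  ultimately show ?thesis by simp
qed

text \<open>For each \<open>n\<close>, having at most \<open>n\<close> points in every ball is a
  null event: the count in the ball of radius \<open>m\<close> is Poisson with mean tending to
  infinity, so the probability \<open>q m\<close> of at most \<open>n\<close> points tends to
  0.\<close>

lemma AE_poisson_infinite:
  fixes \<Phi> :: "'a \<Rightarrow> (real ^ 2) set"
  assumes pp: "poisson_process lam \<Phi>" and "lam > 0"
  shows "AE \<omega> in M. infinite (\<Phi> \<omega>)"
proof -
  note [measurable] = poisson_process_measurable[OF pp]
  have "AE \<omega> in M. \<exists>m::nat. n \<le> card (\<Phi> \<omega> \<inter> cball 0 (real m))" for n
  proof -
    define B where "B = {\<omega> \<in> space M. \<forall>m::nat. card (\<Phi> \<omega> \<inter> cball 0 (real m)) \<le> n}"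
    define q where "q m = (\<Sum>j\<le>n. (lam * pi * (real m)\<^sup>2) ^ j / fact j * exp (- (lam * pi * (real m)\<^sup>2)))" for m
    have [measurable]: "B \<in> events" unfolding B_def by measurable
    have "prob B \<le> q m" for m
    proof -
      have "prob B \<le> prob {\<omega> \<in> space M. card (\<Phi> \<omega> \<inter> cball 0 (real m)) \<le> n}"
        by (rule finite_measure_mono) (auto simp: B_def)
      then show ?thesis
        using prob_poisson_card_cball_le[OF pp, of "real m" n] by (simp add: q_def)
    qed
    moreover have "q \<longlonglongrightarrow> 0"
    proof -
      have lim: "filterlim (\<lambda>m. lam * pi * (real m)\<^sup>2) at_top sequentially"
        using \<open>lam > 0\<close>
        by (intro filterlim_tendsto_pos_mult_at_top[OF tendsto_const]
            filterlim_pow_at_top filterlim_real_sequentially) auto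
      have "(\<lambda>m. (lam * pi * (real m)\<^sup>2) ^ j / fact j * exp (- (lam * pi * (real m)\<^sup>2))) \<longlonglongrightarrow> 0" for j
        using tendsto_divide[OF filterlim_compose[OF tendsto_power_div_exp_0[of j] lim] tendsto_const, of "fact j"]
        by (simp add: exp_minus field_simps)
      then show ?thesis unfolding q_def by (intro tendsto_null_sum)
    qed
    ultimately have "prob B \<le> 0" by (intro LIMSEQ_le_const) auto
    then have "prob B = 0" by (simp add: measure_le_0_iff)
    then have "AE \<omega> in M. \<omega> \<notin> B"
      using AE_iff_measurable[OF \<open>B \<in> events\<close>, of "\<lambda>\<omega>. \<omega> \<notin> B"] sets.sets_into_space[OF \<open>B \<in> events\<close>]
      by (auto simp: emeasure_eq_measure)
    then show ?thesis
      by (rule AE_mp) (auto intro!: AE_I2 simp: B_def not_le intro: less_imp_le)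
  qed
  then have "AE \<omega> in M. \<forall>n. \<exists>m::nat. n \<le> card (\<Phi> \<omega> \<inter> cball 0 (real m))"
    by (simp add: AE_all_countable)
  then show ?thesis
    by (rule AE_mp)
      (auto intro!: AE_I2 simp: infinite_iff_card_cball[OF poisson_process_locally_finite[OF pp]])
qed

text \<open>Almost surely, the squared distance exceeds \<open>a\<close> exactly when the disc of
  radius \<open>sqrt a\<close> holds at most \<open>i - 1\<close> points.
  \<open>erlang_density\<close> takes the shape minus one as its argument, hence the same
  \<open>i - 1\<close>.\<close>

lemma distributed_poisson_ordered_dist_squared:
  fixes \<Phi> :: "'a \<Rightarrow> (real ^ 2) set"
  assumes pp: "poisson_process lam \<Phi>" and "lam > 0" and "i \<ge> 1"
  shows "distributed M lborel (\<lambda>\<omega>. (ordered_dist (\<Phi> \<omega>) i)\<^sup>2) (erlang_density (i - 1) (pi * lam))"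
proof (rule erlang_distributedI)
  note [measurable] = poisson_process_measurable[OF pp]
  note [measurable] = borel_measurable_ordered_dist[OF \<open>i \<ge> 1\<close>]
  show "(\<lambda>\<omega>. (ordered_dist (\<Phi> \<omega>) i)\<^sup>2) \<in> borel_measurable M" by measurable
  show "0 < pi * lam" using \<open>lam > 0\<close> by simp
  fix a :: real assume "0 \<le> a"
  have le: "(ordered_dist (\<Phi> \<omega>) i)\<^sup>2 \<le> a \<longleftrightarrow> ordered_dist (\<Phi> \<omega>) i \<le> sqrt a" for \<omega>
    using real_sqrt_le_iff[of "(ordered_dist (\<Phi> \<omega>) i)\<^sup>2" a] by (simp add: ordered_dist_def)
  define B where "B = {\<omega> \<in> space M. card (\<Phi> \<omega> \<inter> cball 0 (sqrt a)) \<le> i - 1}"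
  have B[measurable]: "B \<in> events" unfolding B_def by measurable
  have "prob {\<omega> \<in> space M. (ordered_dist (\<Phi> \<omega>) i)\<^sup>2 \<le> a} = prob (space M - B)"
  proof (rule finite_measure_eq_AE)
    show "AE \<omega> in M. \<omega> \<in> {\<omega> \<in> space M. (ordered_dist (\<Phi> \<omega>) i)\<^sup>2 \<le> a} \<longleftrightarrow> \<omega> \<in> space M - B"
      using AE_poisson_infinite[OF pp \<open>lam > 0\<close>]
    proof (rule AE_mp, intro AE_I2 impI)
      fix \<omega> assume "\<omega> \<in> space M" "infinite (\<Phi> \<omega>)"
      then show "\<omega> \<in> {\<omega> \<in> space M. (ordered_dist (\<Phi> \<omega>) i)\<^sup>2 \<le> a} \<longleftrightarrow> \<omega> \<in> space M - B"
        using ordered_dist_le_iff[OF poisson_process_locally_finite[OF pp] _ \<open>i \<ge> 1\<close>] \<open>i \<ge> 1\<close>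
        by (auto simp: le B_def)
    qed
  qed measurable
  also have "\<dots> = 1 - prob B" using B by (rule prob_compl)
  \<comment> \<open>The disc has area \<open>pi * a\<close>, so the Poisson sum up to
    \<open>i - 1\<close> is the sum that \<open>erlang_CDF\<close> subtracts from 1.\<close>
  also have "\<dots> = erlang_CDF (i - 1) (pi * lam) a"
    using prob_poisson_card_cball_le[OF pp, of "sqrt a" "i - 1"] \<open>0 \<le> a\<close>
    by (simp add: B_def erlang_CDF_def mult_ac)
  finally show "emeasure M {\<omega> \<in> space M. (ordered_dist (\<Phi> \<omega>) i)\<^sup>2 \<le> a} =
      ennreal (erlang_CDF (i - 1) (pi * lam) a)"
    by (simp add: emeasure_eq_measure)
qed

text \<open>This is the void probability of a disc. Almost sure nonemptiness enters because
  \<open>infdist\<close> to the empty set is 0 and would not reflect an empty disc.\<close>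

lemma prob_poisson_infdist_greater:
  fixes \<Phi> :: "'a \<Rightarrow> (real ^ 2) set"
  assumes pp: "poisson_process lam \<Phi>" and "lam > 0" and "0 \<le> r"
  shows "prob {\<omega> \<in> space M. r < infdist 0 (\<Phi> \<omega>)} = exp (- (pi * lam * r\<^sup>2))"
proof -
  note [measurable] = poisson_process_measurable[OF pp]
  have "prob {\<omega> \<in> space M. r < infdist 0 (\<Phi> \<omega>)} =
      prob {\<omega> \<in> space M. card (\<Phi> \<omega> \<inter> cball 0 r) \<le> 0}"
  proof (rule finite_measure_eq_AE)
    show "AE \<omega> in M. \<omega> \<in> {\<omega> \<in> space M. r < infdist 0 (\<Phi> \<omega>)} \<longleftrightarrow>
        \<omega> \<in> {\<omega> \<in> space M. card (\<Phi> \<omega> \<inter> cball 0 r) \<le> 0}"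
      using AE_poisson_infinite[OF pp \<open>lam > 0\<close>]
    proof (rule AE_mp, intro AE_I2 impI)
      fix \<omega> assume \<omega>: "\<omega> \<in> space M" "infinite (\<Phi> \<omega>)"
      then have "\<Phi> \<omega> \<noteq> {}" by auto
      from infdist_le_iff_card[OF poisson_process_locally_finite[OF pp \<omega>(1)] this, of r]
      have "r < infdist 0 (\<Phi> \<omega>) \<longleftrightarrow> card (\<Phi> \<omega> \<inter> cball 0 r) \<le> 0" by linarith
      then show "\<omega> \<in> {\<omega> \<in> space M. r < infdist 0 (\<Phi> \<omega>)} \<longleftrightarrow>
        \<omega> \<in> {\<omega> \<in> space M. card (\<Phi> \<omega> \<inter> cball 0 r) \<le> 0}"
        by (simp only: mem_Collect_eq)
    qed
  qed measurable
  then show ?thesis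
    using prob_poisson_card_cball_le[OF pp \<open>0 \<le> r\<close>, of 0] by (simp add: mult_ac)
qed

end

subsection \<open>Rate as a function of distance\<close>

text \<open>Carries the change of variables for absolutely integrable functions over to
  \<open>lborel\<close>. That theorem yields integrability only for the completed measure, so Borel
  measurability of the transformed integrand is a separate assumption.\<close>

lemma set_lborel_integral_substitution:
  fixes f g g' :: "real \<Rightarrow> real"
  assumes S: "S \<in> sets borel"
    and der: "\<And>x. x \<in> S \<Longrightarrow> (g has_field_derivative g' x) (at x within S)"
    and inj: "inj_on g S"
    and meas: "set_borel_measurable borel S (\<lambda>x. \<bar>g' x\<bar> * f (g x))"
    and int: "set_integrable lborel (g ` S) f"
  shows "set_integrable lborel S (\<lambda>x. \<bar>g' x\<bar> * f (g x))"
    and "(LBINT x:g ` S. f x) = (LBINT x:S. \<bar>g' x\<bar> * f (g x))"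
proof -
  have "f absolutely_integrable_on g ` S"
    using integrable_completion[OF borel_measurable_integrable] int
    unfolding set_integrable_def by blast
  then have *: "(\<lambda>x. \<bar>g' x\<bar> * f (g x)) absolutely_integrable_on S"
      "integral S (\<lambda>x. \<bar>g' x\<bar> * f (g x)) = integral (g ` S) f"
    using has_absolute_integral_change_of_variables_1'[of S g g' f "integral (g ` S) f"] S der inj
    by auto
  from *(1) show int': "set_integrable lborel S (\<lambda>x. \<bar>g' x\<bar> * f (g x))"
    using meas unfolding set_integrable_def set_borel_measurable_def
    by (subst (asm) integrable_completion) auto
  show "(LBINT x:g ` S. f x) = (LBINT x:S. \<bar>g' x\<bar> * f (g x))"
    using *(2) set_borel_integral_eq_integral(2)[OF int] set_borel_integral_eq_integral(2)[OF int']
    by simp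
qed

text \<open>
  The rate at squared distance \<open>t\<close> and the squared distance at rate \<open>z\<close>, where \<open>c\<close> is the ratio
  of transmit to noise power. Squared distances are used because they are Erlang distributed.
\<close>

definition rate_at :: "real \<Rightarrow> real \<Rightarrow> real \<Rightarrow> real" where
  "rate_at b c t = log 2 (1 + c / t powr b)"

definition sqdist_at :: "real \<Rightarrow> real \<Rightarrow> real \<Rightarrow> real" where
  "sqdist_at b c z = (c / (2 powr z - 1)) powr (1 / b)"

lemma borel_measurable_rate_at [measurable]: "rate_at b c \<in> borel_measurable borel"
  unfolding rate_at_def by measurable

lemma borel_measurable_sqdist_at [measurable]: "sqdist_at b c \<in> borel_measurable borel"
  unfolding sqdist_at_def by measurable

lemma sqdist_at_nonneg: "0 \<le> sqdist_at b c z"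
  by (simp add: sqdist_at_def)

context
  fixes b c :: real
  assumes b: "b > 0" and c: "c > 0"
begin

lemma rate_at_pos: "t > 0 \<Longrightarrow> rate_at b c t > 0"
  using c by (auto simp: rate_at_def intro!: zero_less_log_cancel_iff[THEN iffD2] add_pos_pos)

lemma two_powr_minus_one_pos: "z > 0 \<Longrightarrow> (2::real) powr z - 1 > 0"
  by simp

lemma sqdist_at_pos: "z > 0 \<Longrightarrow> sqdist_at b c z > 0"
  using c two_powr_minus_one_pos[of z] by (auto simp: sqdist_at_def)

text \<open>The inequality is solved for \<open>t\<close>: positivity of \<open>z\<close> keeps
  \<open>2 powr z - 1\<close> positive, taking the reciprocal reverses the order, and the power
  \<open>1 / b\<close> preserves it.\<close>

lemma less_rate_at_iff:
  assumes "t > 0" "z > 0"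
  shows "z < rate_at b c t \<longleftrightarrow> t < sqdist_at b c z"
proof -
  have q: "2 powr z - 1 > 0" using two_powr_minus_one_pos[OF \<open>z > 0\<close>] .
  have "z < rate_at b c t \<longleftrightarrow> 2 powr z < 1 + c / t powr b"
    unfolding rate_at_def using c assms by (subst less_log_iff) (auto intro: add_pos_pos)
  also have "\<dots> \<longleftrightarrow> t powr b < c / (2 powr z - 1)"
    using assms q by (simp add: field_simps)
  also have "\<dots> \<longleftrightarrow> (t powr b) powr (1 / b) < (c / (2 powr z - 1)) powr (1 / b)"
    using b c assms q
    by (smt (verit) powr_less_mono2 powr_mono2 powr_ge_zero divide_pos_pos)
  also have "(t powr b) powr (1 / b) = t"
    using b assms by (simp add: powr_powr)
  finally show ?thesis by (simp add: sqdist_at_def)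
qed

lemma rate_at_sqdist_at:
  assumes "z > 0"
  shows "rate_at b c (sqdist_at b c z) = z"
proof -
  have q: "2 powr z - 1 > 0" using two_powr_minus_one_pos[OF assms] .
  have "sqdist_at b c z powr b = c / (2 powr z - 1)"
    using b c q by (simp add: sqdist_at_def powr_powr)
  then show ?thesis using c q by (simp add: rate_at_def)
qed

lemma sqdist_at_rate_at:
  assumes "t > 0"
  shows "sqdist_at b c (rate_at b c t) = t"
proof -
  have "2 powr rate_at b c t = 1 + c / t powr b"
    using c assms by (simp add: rate_at_def add_pos_pos)
  then show ?thesis using b c assms by (simp add: sqdist_at_def powr_powr)
qed

lemma rate_at_less_iff:
  assumes "t > 0" "z > 0"
  shows "rate_at b c t < z \<longleftrightarrow> sqdist_at b c z < t"
  using less_rate_at_iff[OF assms] rate_at_sqdist_at[OF assms(2)] sqdist_at_rate_at[OF assms(1)]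
  by (metis linorder_neqE order_less_asym)

lemma inj_on_sqdist_at: "0 \<le> \<rho> \<Longrightarrow> inj_on (sqdist_at b c) {\<rho><..}"
  by (rule inj_on_inverseI[where g = "rate_at b c"]) (auto intro: rate_at_sqdist_at)

lemma sqdist_at_image:
  assumes "0 \<le> \<rho>"
  shows "sqdist_at b c ` {\<rho><..} = {t. 0 < t \<and> \<rho> < rate_at b c t}"
proof safe
  fix t assume "0 < t" "\<rho> < rate_at b c t"
  then show "t \<in> sqdist_at b c ` {\<rho><..}"
    using sqdist_at_rate_at[of t] by (intro image_eqI[where x = "rate_at b c t"]) auto
qed (use assms sqdist_at_pos rate_at_sqdist_at in auto)

text \<open>The derivative is written as a multiple of \<open>sqdist_at\<close> itself, so that this
  factor can merge with the power in the Erlang density.\<close>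

lemma has_field_derivative_sqdist_at:
  assumes "z > 0"
  shows "(sqdist_at b c has_field_derivative
      - (ln 2 * 2 powr z / (b * (2 powr z - 1)) * sqdist_at b c z)) (at z within S)"
proof -
  have q: "2 powr z - 1 > 0" using two_powr_minus_one_pos[OF assms] .
  have "((\<lambda>z. (c / (2 powr z - 1)) powr (1 / b)) has_field_derivative
      (1 / b) * (c / (2 powr z - 1)) powr (1 / b - 1) *
        (- (c * (2 powr z * ln 2)) / (2 powr z - 1)\<^sup>2)) (at z)"
    using q b c by (auto intro!: derivative_eq_intros simp: power2_eq_square)
  also have "(c / (2 powr z - 1)) powr (1 / b - 1) =
      sqdist_at b c z / (c / (2 powr z - 1))"
    using q c by (simp add: powr_diff sqdist_at_def)
  also have "(1 / b) * (sqdist_at b c z / (c / (2 powr z - 1))) *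
        (- (c * (2 powr z * ln 2)) / (2 powr z - 1)\<^sup>2) =
      - (ln 2 * 2 powr z / (b * (2 powr z - 1)) * sqdist_at b c z)"
    using b c less_imp_neq[OF q] by (simp add: power2_eq_square)
  finally have *: "((\<lambda>z. (c / (2 powr z - 1)) powr (1 / b)) has_field_derivative
      - (ln 2 * 2 powr z / (b * (2 powr z - 1)) * sqdist_at b c z)) (at z)" .
  have "sqdist_at b c = (\<lambda>z. (c / (2 powr z - 1)) powr (1 / b))"
    by (simp add: sqdist_at_def fun_eq_iff)
  with * show ?thesis by (auto intro: has_field_derivative_at_within)
qed

text \<open>Jacobian times density. The factor \<open>sqdist_at\<close> of the Jacobian raises the
  Erlang power from \<open>i - 1\<close> to \<open>i\<close>, which contributes
  \<open>q powr (real i / b)\<close> to the denominator, where \<open>q = 2 powr z - 1\<close>; the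
  factor \<open>q\<close> in the denominator of the Jacobian adds 1 to that exponent.\<close>

lemma erlang_density_sqdist_at:
  assumes "z > 0" "i \<ge> 1"
  shows "\<bar>- (ln 2 * 2 powr z / (b * (2 powr z - 1)) * sqdist_at b c z)\<bar> *
      erlang_density (i - 1) l (sqdist_at b c z) =
    ln 2 * l ^ i / (fact (i - 1) * b) * c powr (real i / b) *
      (2 powr z / (2 powr z - 1) powr (1 + real i / b) * exp (- l * sqdist_at b c z))"
proof -
  define q where "q = (2::real) powr z - 1"
  have q: "q > 0" using two_powr_minus_one_pos[OF assms(1)] by (simp add: q_def)
  obtain j where i: "i = Suc j" using \<open>i \<ge> 1\<close> by (cases i) auto
  have "sqdist_at b c z * sqdist_at b c z ^ (i - 1) = sqdist_at b c z ^ i"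
    by (simp add: i)
  also have "\<dots> = sqdist_at b c z powr real i"
    by (rule powr_realpow[OF sqdist_at_pos[OF assms(1)], symmetric])
  also have "\<dots> = c powr (real i / b) / q powr (real i / b)"
    using q c by (simp add: sqdist_at_def q_def[symmetric] powr_powr powr_divide)
  finally have pow: "sqdist_at b c z * sqdist_at b c z ^ (i - 1) =
      c powr (real i / b) / q powr (real i / b)" .
  have "\<bar>- (ln 2 * 2 powr z / (b * q) * sqdist_at b c z)\<bar> *
      erlang_density (i - 1) l (sqdist_at b c z) =
    ln 2 * 2 powr z / (b * q) * (l ^ i / fact (i - 1)) * exp (- l * sqdist_at b c z) *
      (sqdist_at b c z * sqdist_at b c z ^ (i - 1))"
    using b q sqdist_at_pos[OF assms(1)]
    by (simp add: erlang_density_def i abs_mult)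
  also have "\<dots> = ln 2 * l ^ i / (fact (i - 1) * b) * c powr (real i / b) *
      (2 powr z / (q * q powr (real i / b)) * exp (- l * sqdist_at b c z))"
    unfolding pow using q b by (simp add: mult_ac)
  also have "q * q powr (real i / b) = q powr (1 + real i / b)"
    using q by (simp add: powr_add)
  finally show ?thesis unfolding q_def .
qed

end

subsection \<open>Distribution of the secrecy rate\<close>

text \<open>By independence the joint law is a product, so the probability is an integral over the
  values \<open>t\<close> of \<open>X\<close>. Given \<open>t\<close>, the event says that the rate
  at \<open>Y\<close> lies below \<open>rate_at b c t - \<rho>\<close>, which for a positive
  threshold means that \<open>Y\<close> exceeds the corresponding squared distance.\<close>

lemma (in prob_space) prob_rate_diff_greater:
  fixes X Y :: "'a \<Rightarrow> real"
  assumes b: "b > 0" and c: "c > 0" and "0 \<le> \<rho>" and l: "0 < l"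
    and X: "distributed M lborel X (erlang_density k l)"
    and Y: "\<And>q. 0 \<le> q \<Longrightarrow> prob {\<omega> \<in> space M. q < Y \<omega>} = exp (- (m * q))"
    and indep: "indep_var borel X borel Y"
  defines "h \<equiv> (\<lambda>t. erlang_density k l t * exp (- (m * sqdist_at b c (rate_at b c t - \<rho>))))"
  shows "set_integrable lborel {t. 0 < t \<and> \<rho> < rate_at b c t} h"
    and "prob {\<omega> \<in> space M. \<rho> < rate_at b c (X \<omega>) - rate_at b c (Y \<omega>)} =
      (LBINT t:{t. 0 < t \<and> \<rho> < rate_at b c t}. h t)"
proof -
  define A where "A = {(t, y). \<rho> < rate_at b c t - rate_at b c y}"
  define T where "T = {t. 0 < t \<and> \<rho> < rate_at b c t}"
  have [measurable]: "X \<in> borel_measurable M" "Y \<in> borel_measurable M"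
    using indep by (auto dest: indep_var_rv1 indep_var_rv2)
  have T[measurable]: "T \<in> sets borel" unfolding T_def by measurable
  have "A = {p \<in> space (borel \<Otimes>\<^sub>M borel). \<rho> < rate_at b c (fst p) - rate_at b c (snd p)}"
    by (auto simp: A_def space_pair_measure)
  also have "\<dots> \<in> sets (borel \<Otimes>\<^sub>M borel)" by measurable
  finally have A: "A \<in> sets (borel \<Otimes>\<^sub>M borel)" .
  have [measurable]: "h \<in> borel_measurable borel" unfolding h_def by measurable
  interpret Y: prob_space "distr M borel Y" by (rule prob_space_distr) measurable
  have h_nonneg: "0 \<le> h t" for t using l by (simp add: h_def)
  have h0: "h t = 0" if "t < 0" for t using that by (simp add: h_def erlang_density_def)
  \<comment> \<open>The tail formula at 0 gives probability 1. Positivity matters because division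
    by zero makes \<open>rate_at\<close> equal to 0 at distance 0, where the true rate is
    infinite.\<close>
  have Y_pos: "AE \<omega> in M. 0 < Y \<omega>"
    using Y[of 0] by (subst prob_Collect_eq_1[symmetric]) auto
  \<comment> \<open>The point \<open>t = 0\<close>, where \<open>rate_at\<close> has only a default
    value, is left out here and discarded later as a Lebesgue null set.\<close>
  have fibre: "erlang_density k l t * emeasure (distr M borel Y) (Pair t -` A) =
      ennreal (h t) * indicator T t" if "t \<noteq> 0" for t
  proof (cases "0 < t")
    case True
    have eq: "emeasure (distr M borel Y) (Pair t -` A) =
        prob {\<omega> \<in> space M. rate_at b c (Y \<omega>) < rate_at b c t - \<rho>}"
      by (subst emeasure_distr)
        (auto simp: A_def emeasure_eq_measure algebra_simps intro!: arg_cong[where f = prob])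
    show ?thesis
    proof (cases "\<rho> < rate_at b c t")
      case less: True
      have "prob {\<omega> \<in> space M. rate_at b c (Y \<omega>) < rate_at b c t - \<rho>} =
          prob {\<omega> \<in> space M. sqdist_at b c (rate_at b c t - \<rho>) < Y \<omega>}"
      proof (rule finite_measure_eq_AE)
        show "AE \<omega> in M. \<omega> \<in> {\<omega> \<in> space M. rate_at b c (Y \<omega>) < rate_at b c t - \<rho>} \<longleftrightarrow>
            \<omega> \<in> {\<omega> \<in> space M. sqdist_at b c (rate_at b c t - \<rho>) < Y \<omega>}"
          using Y_pos by (rule AE_mp) (use less in \<open>auto intro!: AE_I2 simp: rate_at_less_iff[OF b c]\<close>)
      qed measurable
      then show ?thesis
        using True less l unfolding eq
        by (simp add: Y sqdist_at_nonneg h_def T_def ennreal_mult)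
    next
      case False
      \<comment> \<open>The threshold is not positive here, while the rate at \<open>Y\<close> is
        almost surely positive.\<close>
      have "prob {\<omega> \<in> space M. rate_at b c (Y \<omega>) < rate_at b c t - \<rho>} = prob {}"
      proof (rule finite_measure_eq_AE)
        show "AE \<omega> in M. \<omega> \<in> {\<omega> \<in> space M. rate_at b c (Y \<omega>) < rate_at b c t - \<rho>} \<longleftrightarrow> \<omega> \<in> {}"
          using Y_pos
        proof (rule AE_mp, intro AE_I2 impI)
          fix \<omega> assume "0 < Y \<omega>"
          from rate_at_pos[OF b c this] False
          show "\<omega> \<in> {\<omega> \<in> space M. rate_at b c (Y \<omega>) < rate_at b c t - \<rho>} \<longleftrightarrow> \<omega> \<in> {}" by auto
        qed
      qed measurable
      then show ?thesis using False unfolding eq by (simp add: T_def)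
    qed
  next
    case False
    then show ?thesis using that by (simp add: T_def erlang_density_def)
  qed
  have "emeasure M {\<omega> \<in> space M. \<rho> < rate_at b c (X \<omega>) - rate_at b c (Y \<omega>)} =
      emeasure (distr M (borel \<Otimes>\<^sub>M borel) (\<lambda>\<omega>. (X \<omega>, Y \<omega>))) A"
    using A by (subst emeasure_distr) (auto simp: A_def intro!: arg_cong[where f = "emeasure M"])
  also have "distr M (borel \<Otimes>\<^sub>M borel) (\<lambda>\<omega>. (X \<omega>, Y \<omega>)) = distr M borel X \<Otimes>\<^sub>M distr M borel Y"
    using indep by (simp add: indep_var_distribution_eq)
  also have "emeasure \<dots> A = (\<integral>\<^sup>+ t. emeasure (distr M borel Y) (Pair t -` A) \<partial>distr M borel X)"
    using A by (intro Y.emeasure_pair_measure_alt) simp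
  also have "distr M borel X = density lborel (erlang_density k l)"
    using distributed_distr_eq_density[OF X] by (simp cong: distr_cong)
  also have "(\<integral>\<^sup>+ t. emeasure (distr M borel Y) (Pair t -` A) \<partial>density lborel (erlang_density k l)) =
      (\<integral>\<^sup>+ t. erlang_density k l t * emeasure (distr M borel Y) (Pair t -` A) \<partial>lborel)"
  proof (rule nn_integral_density)
    have "(\<lambda>t. emeasure (distr M borel Y) (Pair t -` A)) \<in> borel_measurable borel"
      using A by (intro Y.measurable_emeasure_Pair) simp
    then show "(\<lambda>t. emeasure (distr M borel Y) (Pair t -` A)) \<in> borel_measurable lborel" by simp
  qed measurable
  also have "\<dots> = (\<integral>\<^sup>+ t. ennreal (h t) * indicator T t \<partial>lborel)"
    using AE_lborel_singleton[of "0 :: real"] by (intro nn_integral_cong_AE) (auto simp: fibre)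
  also have "\<dots> = (\<integral>\<^sup>+ t. ennreal (indicator T t *\<^sub>R h t) \<partial>lborel)"
    by (intro nn_integral_cong) (auto split: split_indicator)
  finally have eq: "ennreal (prob {\<omega> \<in> space M. \<rho> < rate_at b c (X \<omega>) - rate_at b c (Y \<omega>)}) =
      (\<integral>\<^sup>+ t. ennreal (indicator T t *\<^sub>R h t) \<partial>lborel)"
    by (simp add: emeasure_eq_measure)
  have nonneg: "0 \<le> indicator T t *\<^sub>R h t" for t using h_nonneg by simp
  \<comment> \<open>Finiteness needs no estimate, because the nonnegative integral equals a
    probability.\<close>
  have "integrable lborel (\<lambda>t. indicator T t *\<^sub>R h t)"
    by (rule integrableI_nonneg) (use nonneg eq[symmetric] in auto)
  then show "set_integrable lborel {t. 0 < t \<and> \<rho> < rate_at b c t} h"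
    by (simp add: set_integrable_def T_def)
  show "prob {\<omega> \<in> space M. \<rho> < rate_at b c (X \<omega>) - rate_at b c (Y \<omega>)} =
      (LBINT t:{t. 0 < t \<and> \<rho> < rate_at b c t}. h t)"
    using nonneg eq[symmetric]
    by (simp add: set_lebesgue_integral_def T_def[symmetric] integral_eq_nn_integral)
qed

text \<open>Passing to squared distances halves the exponent \<open>2 * b\<close>, and the two
  powers enter only through their ratio.\<close>

lemma max_secrecy_rate_eq:
  fixes L E :: "'a::real_normed_vector set"
  assumes "s2 > 0"
  shows "max_secrecy_rate b P s2 L E i =
    max (rate_at b (P / s2) ((ordered_dist L i)\<^sup>2) - rate_at b (P / s2) ((infdist 0 E)\<^sup>2)) 0"
proof -
  have "r\<^sup>2 powr b = r powr (2 * b)" if "0 \<le> r" for r :: real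
    using that powr_powr[of r 2 b] by (cases "r = 0") simp_all
  then show ?thesis
    by (simp add: max_secrecy_rate_def rate_at_def ordered_dist_def mult.commute infdist_nonneg)
qed

theorem theorem5p1:
  fixes M :: "'w measure"
    and \<Pi>\<^sub>l \<Pi>\<^sub>e :: "'w \<Rightarrow> (real ^ 2) set"
    and lam\<^sub>l lam\<^sub>e b P s2 :: real
    and i :: nat
  defines "R \<equiv> (\<lambda>\<omega>. max_secrecy_rate b P s2 (\<Pi>\<^sub>l \<omega>) (\<Pi>\<^sub>e \<omega>) i)"
    and "f \<equiv> (\<lambda>\<rho> z :: real.
           2 powr z / (2 powr z - 1) powr (1 + real i / b)
           * exp (- pi * lam\<^sub>l * ((P / s2) / (2 powr z - 1)) powr (1 / b)
                  - pi * lam\<^sub>e * ((P / s2) / (2 powr (z - \<rho>) - 1)) powr (1 / b)))"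
  assumes "prob_space M"
    and "lam\<^sub>l > 0" and "lam\<^sub>e > 0" and "b > 0" and "P > 0" and "s2 > 0" and "i \<ge> 1"
    and "prob_space.poisson_process M lam\<^sub>l \<Pi>\<^sub>l"
    and "prob_space.poisson_process M lam\<^sub>e \<Pi>\<^sub>e"
    and "prob_space.indep_var M configurations \<Pi>\<^sub>l configurations \<Pi>\<^sub>e"
  shows "R \<in> borel_measurable M \<and>
    (\<forall>\<rho>\<ge>0. interval_lebesgue_integrable lborel \<rho> \<infinity> (f \<rho>) \<and>
       cdf (distr M borel R) \<rho> =
         1 - ln 2 * (pi * lam\<^sub>l) ^ i / (fact (i - 1) * b) * (P / s2) powr (real i / b)
             * (LBINT z=\<rho>..\<infinity>. f \<rho> z))"
proof -
  interpret prob_space M by fact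
  note ppl = \<open>poisson_process lam\<^sub>l \<Pi>\<^sub>l\<close> and ppe = \<open>poisson_process lam\<^sub>e \<Pi>\<^sub>e\<close>
  note [measurable] = poisson_process_measurable[OF ppl] poisson_process_measurable[OF ppe]
    borel_measurable_ordered_dist[OF \<open>i \<ge> 1\<close>]
  define c where "c = P / s2"
  have c: "c > 0" using \<open>P > 0\<close> \<open>s2 > 0\<close> by (simp add: c_def)
  note b = \<open>b > 0\<close>
  define X where "X \<omega> = (ordered_dist (\<Pi>\<^sub>l \<omega>) i)\<^sup>2" for \<omega>
  define Y where "Y \<omega> = (infdist 0 (\<Pi>\<^sub>e \<omega>))\<^sup>2" for \<omega>
  have R: "R = (\<lambda>\<omega>. max (rate_at b c (X \<omega>) - rate_at b c (Y \<omega>)) 0)"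
    using \<open>s2 > 0\<close> by (simp add: R_def max_secrecy_rate_eq X_def Y_def c_def)
  have [measurable]: "X \<in> borel_measurable M" "Y \<in> borel_measurable M"
    unfolding X_def Y_def by measurable
  have R_meas[measurable]: "R \<in> borel_measurable M" unfolding R by measurable
  have distX: "distributed M lborel X (erlang_density (i - 1) (pi * lam\<^sub>l))"
    unfolding X_def
    using distributed_poisson_ordered_dist_squared[OF ppl \<open>lam\<^sub>l > 0\<close> \<open>i \<ge> 1\<close>] .
  have distY: "prob {\<omega> \<in> space M. q < Y \<omega>} = exp (- (pi * lam\<^sub>e * q))" if "0 \<le> q" for q
  proof -
    have "q < Y \<omega> \<longleftrightarrow> sqrt q < infdist 0 (\<Pi>\<^sub>e \<omega>)" for \<omega>
      using real_sqrt_less_iff[of q "Y \<omega>"] by (simp add: Y_def infdist_nonneg)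
    then show ?thesis
      using prob_poisson_infdist_greater[OF ppe \<open>lam\<^sub>e > 0\<close>, of "sqrt q"] that by simp
  qed
  \<comment> \<open>Each squared distance is a measurable function of one configuration alone, so
    independence of the processes is inherited.\<close>
  have indep: "indep_var borel X borel Y"
    using indep_var_compose[OF \<open>indep_var configurations \<Pi>\<^sub>l configurations \<Pi>\<^sub>e\<close>,
        of "\<lambda>S. (ordered_dist S i)\<^sup>2" borel "\<lambda>S. (infdist 0 S)\<^sup>2" borel]
    by (simp add: X_def[abs_def] Y_def[abs_def] comp_def)
  define K where "K = ln 2 * (pi * lam\<^sub>l) ^ i / (fact (i - 1) * b) * c powr (real i / b)"
  \<comment> \<open>A nonzero \<open>K\<close> can be cancelled when integrability of
    \<open>K * f \<rho> z\<close> is turned into that of \<open>f \<rho>\<close>.\<close>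
  have "K > 0" using b c \<open>lam\<^sub>l > 0\<close> by (simp add: K_def)
  have main: "set_integrable lborel {\<rho><..} (f \<rho>) \<and>
      prob {\<omega> \<in> space M. \<rho> < rate_at b c (X \<omega>) - rate_at b c (Y \<omega>)} = K * (LBINT z:{\<rho><..}. f \<rho> z)"
    if "0 \<le> \<rho>" for \<rho>
  proof -
    define h where "h t = erlang_density (i - 1) (pi * lam\<^sub>l) t *
      exp (- (pi * lam\<^sub>e * sqdist_at b c (rate_at b c t - \<rho>)))" for t
    define g' where "g' z = - (ln 2 * 2 powr z / (b * (2 powr z - 1)) * sqdist_at b c z)" for z
    have h: "set_integrable lborel (sqdist_at b c ` {\<rho><..}) h"
      "prob {\<omega> \<in> space M. \<rho> < rate_at b c (X \<omega>) - rate_at b c (Y \<omega>)} =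
        (LBINT t:sqdist_at b c ` {\<rho><..}. h t)"
      unfolding sqdist_at_image[OF b c that] h_def
      using prob_rate_diff_greater[OF b c that _ distX distY indep] \<open>lam\<^sub>l > 0\<close> by simp_all
    \<comment> \<open>Along the substitution the rate at \<open>sqdist_at b c z\<close> is
      \<open>z\<close> again, so the eavesdropper factor of \<open>h\<close> becomes a function of
      \<open>z - \<rho>\<close>.\<close>
    have integrand: "\<bar>g' z\<bar> * h (sqdist_at b c z) = K * f \<rho> z" if "z \<in> {\<rho><..}" for z
    proof -
      have "z > 0" using that \<open>0 \<le> \<rho>\<close> by simp
      have "f \<rho> z = 2 powr z / (2 powr z - 1) powr (1 + real i / b) *
          exp (- (pi * lam\<^sub>l) * sqdist_at b c z) * exp (- (pi * lam\<^sub>e * sqdist_at b c (z - \<rho>)))"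
        by (simp add: f_def sqdist_at_def c_def exp_diff exp_minus divide_inverse)
      moreover have "h (sqdist_at b c z) = erlang_density (i - 1) (pi * lam\<^sub>l) (sqdist_at b c z) *
          exp (- (pi * lam\<^sub>e * sqdist_at b c (z - \<rho>)))"
        by (simp add: h_def rate_at_sqdist_at[OF b c \<open>z > 0\<close>])
      ultimately show ?thesis
        using erlang_density_sqdist_at[OF b c \<open>z > 0\<close> \<open>i \<ge> 1\<close>, of "pi * lam\<^sub>l"]
        unfolding K_def g'_def by (simp only: mult.assoc[symmetric])
    qed
    have "set_integrable lborel {\<rho><..} (\<lambda>z. \<bar>g' z\<bar> * h (sqdist_at b c z))"
      "(LBINT t:sqdist_at b c ` {\<rho><..}. h t) = (LBINT z:{\<rho><..}. \<bar>g' z\<bar> * h (sqdist_at b c z))"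
    proof -
      have der: "(sqdist_at b c has_field_derivative g' z) (at z within {\<rho><..})"
        if "z \<in> {\<rho><..}" for z
        unfolding g'_def using that \<open>0 \<le> \<rho>\<close> by (intro has_field_derivative_sqdist_at[OF b c]) auto
      have meas: "set_borel_measurable borel {\<rho><..} (\<lambda>z. \<bar>g' z\<bar> * h (sqdist_at b c z))"
        unfolding set_borel_measurable_def g'_def h_def by measurable
      note subst = set_lborel_integral_substitution[OF _ der
          inj_on_sqdist_at[OF b c that] meas h(1)]
      show "set_integrable lborel {\<rho><..} (\<lambda>z. \<bar>g' z\<bar> * h (sqdist_at b c z))"
        by (rule subst) auto
      show "(LBINT t:sqdist_at b c ` {\<rho><..}. h t) =
          (LBINT z:{\<rho><..}. \<bar>g' z\<bar> * h (sqdist_at b c z))"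
        by (rule subst) auto
    qed
    moreover have "set_integrable lborel {\<rho><..} (\<lambda>z. \<bar>g' z\<bar> * h (sqdist_at b c z)) \<longleftrightarrow>
        set_integrable lborel {\<rho><..} (\<lambda>z. K * f \<rho> z)"
      by (rule set_integrable_cong) (auto simp: integrand)
    moreover have "(LBINT z:{\<rho><..}. \<bar>g' z\<bar> * h (sqdist_at b c z)) = (LBINT z:{\<rho><..}. K * f \<rho> z)"
      by (rule set_lebesgue_integral_cong) (auto simp: integrand)
    ultimately show ?thesis using h(2) \<open>K > 0\<close> by simp
  qed
  have "cdf (distr M borel R) \<rho> = 1 - K * (LBINT z=\<rho>..\<infinity>. f \<rho> z)" if "0 \<le> \<rho>" for \<rho>
  proof -
    have "cdf (distr M borel R) \<rho> = prob {\<omega> \<in> space M. \<not> \<rho> < R \<omega>}"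
      by (simp add: cdf_def measure_distr vimage_def Int_def not_less conj_commute)
    also have "\<dots> = 1 - prob {\<omega> \<in> space M. \<rho> < R \<omega>}"
      by (rule prob_neg) measurable
    \<comment> \<open>Since \<open>\<rho>\<close> is nonnegative, truncation at 0 does not affect
      exceeding it. Strict exceedance also puts the event \<open>R = 0\<close> into the distribution
      function at \<open>\<rho> = 0\<close>.\<close>
    also have "{\<omega> \<in> space M. \<rho> < R \<omega>} =
        {\<omega> \<in> space M. \<rho> < rate_at b c (X \<omega>) - rate_at b c (Y \<omega>)}"
      using that by (auto simp: R)
    finally show ?thesis
      using main[OF that] by (simp add: interval_integral_to_infinity_eq)
  qed
  then show ?thesis
    using R_meas main by (simp add: interval_integrable_to_infinity_eq K_def c_def)
qed

end
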